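(* Let $D$ be a semicomplete digraph. Then $$\chi'_{\mathrm{wo}}(D) = \begin{cases} 0 & \text{if } D = K_1,\\ 1 & \text{if } D \text{ is nontrivial and every semi-degree } d_D^+(v), d_D^-(v) \ (v\in V(D)) \text{ is odd or zero},\\ 3 & \text{if } D \text{ is a nontrivial even digraph with exactly one peripheral vertex},\\ 2 & \text{otherwise.}\end{cases}$$
   Context: All digraphs are finite, without loops or parallel arcs (a pair of opposite arcs $uv, vu$ is allowed). A digraph $D$ is semicomplete if every pair of distinct vertices is joined by at least one arc (in one or both directions). For a vertex $v$, the semi-cuts of $v$ are $\partial_D^+(v)=\{vw\in A(D)\}$ and $\partial_D^-(v)=\{uv\in A(D)\}$; the semi-degrees are $d_D^+(v)=|\partial_D^+(v)|$ and $d_D^-(v)=|\partial_D^-(v)|$, and $d_D(v)=d_D^+(v)+d_D^-(v)$. A map $\varphi:A(D)\to[k]=\{1,\dots,k\}$ satisfies condition (WO) at $v$ if there is a color $i\in[k]$ such that every nonempty semi-cut of $v$ contains an odd number of arcs of color $i$ (vacuously true if both semi-cuts are empty). $\varphi$ is a weak-odd $k$-edge coloring if (WO) holds at every vertex. The weak-odd chromatic index $\chi'_{\mathrm{wo}}(D)$ is the least integer $k\ge 0$ such that $D$ has a weak-odd $k$-edge coloring. A vertex $v$ is peripheral if $d_D^+(v)=0$ or $d_D^-(v)=0$. $D$ is even if $d_D(v)$ is even for every vertex $v$. $D$ is nontrivial if it has more than one vertex. *)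

theory Defs
  imports "Graph_Theory.Digraph" "Graph_Theory.Kuratowski" "HOL-Library.FuncSet"
begin

locale semicomplete_digraph = digraph D for D :: "('a, 'b) pre_digraph" +
  assumes semicomplete:
    "\<And>u v. u \<in> verts D \<Longrightarrow> v \<in> verts D \<Longrightarrow> u \<noteq> v \<Longrightarrow> u \<rightarrow>\<^bsub>D\<^esub> v \<or> v \<rightarrow>\<^bsub>D\<^esub> u"

definition total_degree :: "('a, 'b) pre_digraph \<Rightarrow> 'a \<Rightarrow> nat" where
  "total_degree D v = out_degree D v + in_degree D v"

text \<open>The first disjunct matters only for \<open>k = 0\<close>: a vertex with two empty semi-cuts satisfies
  the condition even when no color is available.\<close>

definition weak_odd_at :: "('a, 'b) pre_digraph \<Rightarrow> nat \<Rightarrow> ('b \<Rightarrow> nat) \<Rightarrow> 'a \<Rightarrow> bool" where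
  "weak_odd_at D k \<phi> v \<longleftrightarrow>
     (out_arcs D v = {} \<and> in_arcs D v = {}) \<or>
     (\<exists>i\<in>{1..k}. \<forall>S\<in>{out_arcs D v, in_arcs D v}. S \<noteq> {} \<longrightarrow> odd (card {e \<in> S. \<phi> e = i}))"

definition weak_odd_edge_coloring :: "('a, 'b) pre_digraph \<Rightarrow> nat \<Rightarrow> ('b \<Rightarrow> nat) \<Rightarrow> bool" where
  "weak_odd_edge_coloring D k \<phi> \<longleftrightarrow>
     \<phi> \<in> arcs D \<rightarrow> {1..k} \<and> (\<forall>v\<in>verts D. weak_odd_at D k \<phi> v)"

definition weak_odd_chromatic_index :: "('a, 'b) pre_digraph \<Rightarrow> nat" where
  "weak_odd_chromatic_index D = (LEAST k. \<exists>\<phi>. weak_odd_edge_coloring D k \<phi>)"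

definition peripheral :: "('a, 'b) pre_digraph \<Rightarrow> 'a \<Rightarrow> bool" where
  "peripheral D v \<longleftrightarrow> out_degree D v = 0 \<or> in_degree D v = 0"

definition even_digraph :: "('a, 'b) pre_digraph \<Rightarrow> bool" where
  "even_digraph D \<longleftrightarrow> (\<forall>v\<in>verts D. even (total_degree D v))"

definition nontrivial_digraph :: "('a, 'b) pre_digraph \<Rightarrow> bool" where
  "nontrivial_digraph D \<longleftrightarrow> card (verts D) > 1"

end

theory Submission
  imports Defs
begin

text \<open>Split every vertex \<open>v\<close> into an out-copy and an in-copy, so that arcs become the edges of a
  bipartite graph. A weak-odd 2-coloring amounts to a set \<open>F\<close> of arcs whose degree parities in this
  graph are prescribed, with two choices at each vertex; such an \<open>F\<close> exists as soon as every
  component has an even number of odd prescriptions. Without peripheral vertices all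
  prescriptions can be odd, because semicompleteness makes every component even. With a source
  (or, dually, a sink) the graph is connected up to isolated vertices, and only the total parity
  matters: it can be adjusted unless \<open>D\<close> is even and has no further peripheral vertex. In that
  exceptional case the handshake lemma excludes two colors, while giving a third color to one
  arc at the peripheral vertex suffices.\<close>

section \<open>Parity-prescribed arc sets in the bipartite split\<close>

definition toggle :: "'a \<Rightarrow> 'a set \<Rightarrow> 'a set" where
  "toggle x A = (if x \<in> A then A - {x} else insert x A)"

lemma odd_card_toggle: "finite A \<Longrightarrow> odd (card (toggle x A)) \<longleftrightarrow> even (card A)"
  by (cases "card A") (auto simp: toggle_def card_Diff_singleton_if)

lemma toggle_Image: "toggle (u, w) F `` {x} = (if x = u then toggle w (F `` {u}) else F `` {x})"
  by (auto simp: toggle_def)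

lemma converse_toggle: "(toggle (u, w) F)\<inverse> = toggle (w, u) (F\<inverse>)"
  by (auto simp: toggle_def)

lemma finite_converse_Image: "finite F \<Longrightarrow> finite (F\<inverse> `` A)"
  by (rule finite_Image) simp

text \<open>The handshake lemma for the bipartite split: both sums count the pairs in
  \<open>F\<close>.\<close>

lemma sum_out_eq_sum_in:
  assumes "finite X" "finite Y" "F \<subseteq> X \<times> Y"
  shows "(\<Sum>u\<in>X. card (F `` {u})) = (\<Sum>w\<in>Y. card (F\<inverse> `` {w}))"
proof -
  have fin: "finite F" using assms finite_subset by blast
  have "F = (SIGMA u:X. F `` {u})" "F\<inverse> = (SIGMA w:Y. F\<inverse> `` {w})" using assms(3) by auto
  then have "card F = (\<Sum>u\<in>X. card (F `` {u}))" "card (F\<inverse>) = (\<Sum>w\<in>Y. card (F\<inverse> `` {w}))"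
    using card_SigmaI[of X "\<lambda>u. F `` {u}"] card_SigmaI[of Y "\<lambda>w. F\<inverse> `` {w}"] assms(1,2) fin
    by (simp_all add: finite_Image finite_converse_Image)
  then show ?thesis by simp
qed

text \<open>In the bipartite split of a relation, \<open>Inl u\<close> carries the arcs leaving \<open>u\<close> and \<open>Inr w\<close>
  those entering \<open>w\<close>; each arc \<open>(u, w)\<close> becomes the undirected edge between \<open>Inl u\<close> and \<open>Inr w\<close>.\<close>

definition half_deg :: "'a rel \<Rightarrow> 'a + 'a \<Rightarrow> nat" where
  "half_deg F x = (case x of Inl u \<Rightarrow> card (F `` {u}) | Inr w \<Rightarrow> card (F\<inverse> `` {w}))"

definition split_adj :: "'a rel \<Rightarrow> ('a + 'a) rel" where
  "split_adj E = {(Inl u, Inr w) |u w. (u, w) \<in> E} \<union> {(Inr w, Inl u) |u w. (u, w) \<in> E}"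

lemma odd_half_deg_toggle:
  assumes "finite F"
  shows "odd (half_deg (toggle (u, w) F) x) \<longleftrightarrow> (odd (half_deg F x) \<noteq> (x = Inl u \<or> x = Inr w))"
  using assms
  by (auto simp: half_deg_def toggle_Image converse_toggle odd_card_toggle finite_Image
      finite_converse_Image split: sum.splits)

text \<open>Toggling an edge flips the parity at its two ends, so along a walk the flips at inner
  vertices cancel. Inequality of truth values serves as exclusive or; in particular nothing changes
  when \<open>x = y\<close>.\<close>

lemma toggle_along_path:
  assumes "(x, y) \<in> (split_adj E)\<^sup>*" "F \<subseteq> E" "finite E"
  shows "\<exists>F'\<subseteq>E. \<forall>z. odd (half_deg F' z) \<longleftrightarrow> (odd (half_deg F z) \<noteq> ((z = x) \<noteq> (z = y)))"
  using assms(1)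
proof (induction rule: rtrancl_induct)
  case base
  show ?case using assms(2) by auto
next
  case (step y y')
  then obtain F' where F': "F' \<subseteq> E"
    "\<And>z. odd (half_deg F' z) \<longleftrightarrow> (odd (half_deg F z) \<noteq> ((z = x) \<noteq> (z = y)))" by blast
  from step.hyps(2) obtain u w where uw: "(u, w) \<in> E"
    "y = Inl u \<and> y' = Inr w \<or> y = Inr w \<and> y' = Inl u"
    unfolding split_adj_def by blast
  have "toggle (u, w) F' \<subseteq> E" using F'(1) uw(1) by (auto simp: toggle_def)
  moreover have "finite F'" using F'(1) assms(3) finite_subset by blast
  then have "odd (half_deg (toggle (u, w) F') z) \<longleftrightarrow> (odd (half_deg F z) \<noteq> ((z = x) \<noteq> (z = y')))"
    for z using F'(2) uw(2) by (auto simp: odd_half_deg_toggle)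
  ultimately show ?case by blast
qed

text \<open>A set of arcs with the fewest even half-degrees has none: two even half-vertices in one
  component of the bipartite split could be repaired along a path, and a component with a single
  one contradicts the handshake lemma.\<close>

lemma exists_odd_factor:
  assumes fin: "finite V" and E: "E \<subseteq> V \<times> V"
    and closed: "\<And>X Y. \<lbrakk>X \<subseteq> V; Y \<subseteq> V; \<And>u w. (u, w) \<in> E \<Longrightarrow> u \<in> X \<longleftrightarrow> w \<in> Y\<rbrakk>
      \<Longrightarrow> even (card X + card Y)"
  shows "\<exists>F\<subseteq>E. \<forall>v\<in>V. odd (card (F `` {v})) \<and> odd (card (F\<inverse> `` {v}))"
proof -
  define bad where "bad F = {x \<in> V <+> V. even (half_deg F x)}" for F :: "'a rel"
  have finE: "finite E" using E fin finite_subset by blast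
  have finbad: "finite (bad F)" for F unfolding bad_def using fin by simp
  obtain F where F: "F \<subseteq> E" "\<And>F'. F' \<subseteq> E \<Longrightarrow> card (bad F) \<le> card (bad F')"
    using ex_has_least_nat[of "\<lambda>F. F \<subseteq> E" "{}" "\<lambda>F. card (bad F)"] by auto
  have "bad F = {}"
  proof (rule ccontr)
    assume "bad F \<noteq> {}"
    then obtain x where x: "x \<in> bad F" by blast
    \<comment> \<open>The component of \<open>x\<close> in the bipartite split; \<open>X\<close> and
      \<open>Y\<close> are its out-copies and in-copies.\<close>
    define C where "C = {y \<in> V <+> V. (x, y) \<in> (split_adj E)\<^sup>*}"
    define X where "X = {u. Inl u \<in> C}"
    define Y where "Y = {w. Inr w \<in> C}"
    have XY: "X \<subseteq> V" "Y \<subseteq> V" unfolding X_def Y_def C_def by auto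
    have finXY: "finite X" "finite Y" using XY fin finite_subset by auto
    have cl: "u \<in> X \<longleftrightarrow> w \<in> Y" if "(u, w) \<in> E" for u w
    proof -
      have "(Inl u, Inr w) \<in> split_adj E" "(Inr w, Inl u) \<in> split_adj E"
        using that unfolding split_adj_def by auto
      then show ?thesis using that E unfolding X_def Y_def C_def
        by (auto intro: rtrancl_into_rtrancl)
    qed
    have only: "y = x" if y: "y \<in> bad F" "y \<in> C" for y
    proof (rule ccontr)
      assume "y \<noteq> x"
      obtain F' where F': "F' \<subseteq> E"
        "\<And>z. odd (half_deg F' z) \<longleftrightarrow> (odd (half_deg F z) \<noteq> ((z = x) \<noteq> (z = y)))"
        using toggle_along_path[of x y E F] y(2) F(1) finE unfolding C_def by blast
      have "bad F' \<subseteq> bad F - {x}"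
        using F'(2) \<open>y \<noteq> x\<close> x y(1) unfolding bad_def by auto
      then have "card (bad F') < card (bad F)"
        using x finbad by (metis Diff_iff insertI1 psubsetI psubset_card_mono subset_iff)
      then show False using F(2)[OF F'(1)] by simp
    qed
    have xC: "x \<in> C" using x unfolding C_def bad_def by simp
    \<comment> \<open>No arc of \<open>E\<close> leaves the component on one side only, so
      restricting \<open>F\<close> to it keeps all its half-degrees and the handshake lemma applies
      there.\<close>
    let ?G = "F \<inter> X \<times> Y"
    have GX: "?G `` {u} = F `` {u}" if "u \<in> X" for u using that cl F(1) by auto
    have GY: "?G\<inverse> `` {w} = F\<inverse> `` {w}" if "w \<in> Y" for w using that cl F(1) by auto
    have "(\<Sum>u\<in>X. card (F `` {u})) = (\<Sum>w\<in>Y. card (F\<inverse> `` {w}))"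
      using sum_out_eq_sum_in[of X Y ?G] finXY GX GY by auto
    then have "even ((\<Sum>u\<in>X. card (F `` {u})) + (\<Sum>w\<in>Y. card (F\<inverse> `` {w})))" by simp
    then have ev: "even (card {u\<in>X. odd (card (F `` {u}))} + card {w\<in>Y. odd (card (F\<inverse> `` {w}))})"
      using finXY by (simp add: even_sum_iff)
    have evC: "even (half_deg F y) \<longleftrightarrow> y = x" if "y \<in> C" for y
      using only[of y] x that unfolding bad_def C_def by auto
    have oX: "odd (card (F `` {u})) \<longleftrightarrow> Inl u \<noteq> x" if "u \<in> X" for u
      using evC[of "Inl u"] that unfolding X_def half_deg_def by auto
    have oY: "odd (card (F\<inverse> `` {w})) \<longleftrightarrow> Inr w \<noteq> x" if "w \<in> Y" for w
      using evC[of "Inr w"] that unfolding Y_def half_deg_def by auto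
    \<comment> \<open>The odd half-vertices of the component are all but \<open>x\<close>; their
      number is even, although the component itself has even size.\<close>
    have ev': "even (card {u\<in>X. Inl u \<noteq> x} + card {w\<in>Y. Inr w \<noteq> x})"
      using ev oX oY by (simp cong: conj_cong)
    have tot: "even (card X + card Y)" using closed XY cl by blast
    show False
    proof (cases x)
      case (Inl u)
      then have "u \<in> X" using xC X_def by simp
      moreover have "{u\<in>X. Inl u \<noteq> x} = X - {u}" "{w\<in>Y. Inr w \<noteq> x} = Y" using Inl by auto
      moreover have "card X = Suc (card (X - {u}))" using \<open>u \<in> X\<close> finXY by (metis card.remove)
      ultimately show False using ev' tot by simp
    next
      case (Inr w)
      then have "w \<in> Y" using xC Y_def by simp
      moreover have "{u\<in>X. Inl u \<noteq> x} = X" "{w\<in>Y. Inr w \<noteq> x} = Y - {w}" using Inr by auto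
      moreover have "card Y = Suc (card (Y - {w}))" using \<open>w \<in> Y\<close> finXY by (metis card.remove)
      ultimately show False using ev' tot by simp
    qed
  qed
  then have "odd (half_deg F (Inl v))" "odd (half_deg F (Inr v))" if "v \<in> V" for v
    using that unfolding bad_def by auto
  then show ?thesis using F(1) unfolding half_deg_def by auto
qed

section \<open>Semicomplete digraphs as relations, where reversing all arcs is just the
  converse\<close>

locale semicomplete_rel =
  fixes V :: "'a set" and E :: "'a rel"
  assumes finite_V: "finite V"
    and E_subset: "E \<subseteq> V \<times> V"
    and irrefl: "(v, v) \<notin> E"
    and joined: "\<lbrakk>u \<in> V; v \<in> V; u \<noteq> v\<rbrakk> \<Longrightarrow> (u, v) \<in> E \<or> (v, u) \<in> E"
begin

lemma finite_E: "finite E"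
  using finite_V E_subset finite_subset by blast

lemma finite_Image_E: "finite (E `` A)" "finite (E\<inverse> `` A)"
  using finite_E by (simp_all add: finite_Image finite_converse_Image)

lemma semicomplete_rel_converse: "semicomplete_rel V (E\<inverse>)"
  using finite_V E_subset irrefl joined by unfold_locales auto

text \<open>\<open>X\<close> and \<open>Y\<close> collect the out-copies and in-copies in a union of
  components. An arc between two vertices of \<open>X - Y\<close>, or of \<open>Y - X\<close>, would
  break closedness, so each difference has at most one element. Without peripheral vertices both are
  empty or both are singletons, hence \<open>X\<close> and \<open>Y\<close> have equal size.\<close>

lemma even_closed_sets:
  assumes nonper: "\<And>v. v \<in> V \<Longrightarrow> E `` {v} \<noteq> {} \<and> E\<inverse> `` {v} \<noteq> {}"
    and XY: "X \<subseteq> V" "Y \<subseteq> V"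
    and cl: "\<And>u w. (u, w) \<in> E \<Longrightarrow> u \<in> X \<longleftrightarrow> w \<in> Y"
  shows "even (card X + card Y)"
proof -
  have fin: "finite X" "finite Y" using XY finite_V finite_subset by auto
  have P: "p = p'" if "p \<in> X - Y" "p' \<in> X - Y" for p p'
    using joined[of p p'] cl[of p p'] cl[of p' p] that XY by auto
  have Q: "q = q'" if "q \<in> Y - X" "q' \<in> Y - X" for q q'
    using joined[of q q'] cl[of q q'] cl[of q' q] that XY by auto
  \<comment> \<open>A vertex with both copies inside and one with both copies outside cannot be
    joined by an arc.\<close>
  have AR: "X \<inter> Y = {} \<or> V \<subseteq> X \<union> Y"
  proof (rule ccontr)
    assume "\<not> ?thesis"
    then obtain a r where "a \<in> X" "a \<in> Y" "r \<in> V" "r \<notin> X" "r \<notin> Y" by blast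
    then show False using joined[of a r] cl[of a r] cl[of r a] XY by auto
  qed
  have nb: "\<exists>w\<in>V. (v, w) \<in> E" "\<exists>w\<in>V. (w, v) \<in> E" if "v \<in> V" for v
    using nonper[OF that] E_subset by auto
  have "X - Y = {} \<longleftrightarrow> Y - X = {}"
  proof
    assume e: "X - Y = {}"
    show "Y - X = {}"
    proof (rule ccontr)
      assume "Y - X \<noteq> {}"
      then obtain q where "q \<in> Y - X" by blast
      then have q: "q \<in> Y" "q \<notin> X" "q \<in> V" using XY by auto
      \<comment> \<open>By \<open>AR\<close> either \<open>X\<close> is empty, which the arc from
        \<open>b\<close> to \<open>q\<close> refutes, or \<open>Y\<close> is all of
        \<open>V\<close>, which the arc from \<open>q\<close> to \<open>a\<close> refutes.\<close>
      obtain a b where "a \<in> V" "(q, a) \<in> E" "b \<in> V" "(b, q) \<in> E" using nb q by blast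
      then show False using AR cl[of q a] cl[of b q] e q by auto
    qed
  next
    assume e: "Y - X = {}"
    show "X - Y = {}"
    proof (rule ccontr)
      assume "X - Y \<noteq> {}"
      then obtain p where "p \<in> X - Y" by blast
      then have p: "p \<in> X" "p \<notin> Y" "p \<in> V" using XY by auto
      obtain a b where "a \<in> V" "(p, a) \<in> E" "b \<in> V" "(b, p) \<in> E" using nb p by blast
      then show False using AR cl[of p a] cl[of b p] e p by auto
    qed
  qed
  moreover have one: "card S = (if S = {} then 0 else 1)" if S: "\<And>x y. x \<in> S \<Longrightarrow> y \<in> S \<Longrightarrow> x = y"
    for S :: "'a set"
  proof (cases "S = {}")
    case False
    then obtain x where "S = {x}" using S by blast
    then show ?thesis by simp
  qed simp
  ultimately have "card (X - Y) = card (Y - X)" using one[OF P] one[OF Q] by presburger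
  moreover have "card X = card (X \<inter> Y) + card (X - Y)" "card Y = card (X \<inter> Y) + card (Y - X)"
    using card_Int_Diff[OF fin(1), of Y] card_Int_Diff[OF fin(2), of X] by (simp_all add: Int_commute)
  ultimately show ?thesis by simp
qed


lemma odd_card_Diff_Image:
  assumes "F \<subseteq> E"
  shows "odd (card ((E - F) `` {v})) \<longleftrightarrow> odd (card (E `` {v})) \<noteq> odd (card (F `` {v}))"
    and "odd (card ((E - F)\<inverse> `` {v})) \<longleftrightarrow> odd (card (E\<inverse> `` {v})) \<noteq> odd (card (F\<inverse> `` {v}))"
proof -
  have "E `` {v} = F `` {v} \<union> (E - F) `` {v}" "E\<inverse> `` {v} = F\<inverse> `` {v} \<union> (E - F)\<inverse> `` {v}"
    using assms by auto
  moreover have "finite (F `` {v})" "finite ((E - F) `` {v})"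
    "finite (F\<inverse> `` {v})" "finite ((E - F)\<inverse> `` {v})"
    using assms by (auto intro: finite_subset[OF _ finite_Image_E(1)[of "{v}"]]
        finite_subset[OF _ finite_Image_E(2)[of "{v}"]])
  moreover have "F `` {v} \<inter> (E - F) `` {v} = {}" "F\<inverse> `` {v} \<inter> (E - F)\<inverse> `` {v} = {}" by auto
  ultimately have "card (E `` {v}) = card (F `` {v}) + card ((E - F) `` {v})"
    "card (E\<inverse> `` {v}) = card (F\<inverse> `` {v}) + card ((E - F)\<inverse> `` {v})"
    by (simp_all add: card_Un_disjoint)
  then show "odd (card ((E - F) `` {v})) \<longleftrightarrow> odd (card (E `` {v})) \<noteq> odd (card (F `` {v}))"
    "odd (card ((E - F)\<inverse> `` {v})) \<longleftrightarrow> odd (card (E\<inverse> `` {v})) \<noteq> odd (card (F\<inverse> `` {v}))"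
    by presburger+
qed

end

section \<open>Weak-odd colorings of relations\<close>

definition odd_at :: "'a rel \<Rightarrow> 'a rel \<Rightarrow> 'a \<Rightarrow> bool" where
  "odd_at E F v \<longleftrightarrow> (E `` {v} \<noteq> {} \<longrightarrow> odd (card (F `` {v})))
     \<and> (E\<inverse> `` {v} \<noteq> {} \<longrightarrow> odd (card (F\<inverse> `` {v})))"

text \<open>Mirrors \<open>weak_odd_edge_coloring\<close> with colors on pairs of vertices;
  \<open>odd_at\<close> is condition (WO) for a single color whose class is its second
  argument.\<close>

definition wo_coloring :: "'a set \<Rightarrow> 'a rel \<Rightarrow> nat \<Rightarrow> ('a \<times> 'a \<Rightarrow> nat) \<Rightarrow> bool" where
  "wo_coloring V E k c \<longleftrightarrow> (\<forall>p\<in>E. c p \<in> {1..k}) \<and>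
     (\<forall>v\<in>V. (E `` {v} = {} \<and> E\<inverse> `` {v} = {}) \<or> (\<exists>i\<in>{1..k}. odd_at E {p \<in> E. c p = i} v))"

lemma odd_at_converse: "odd_at (E\<inverse>) (F\<inverse>) v \<longleftrightarrow> odd_at E F v"
  by (auto simp: odd_at_def)

text \<open>Reversal exchanges the two semi-cuts of every vertex, so results about sources carry
  over to sinks.\<close>

lemma wo_coloring_converse:
  assumes "wo_coloring V (E\<inverse>) k c"
  shows "wo_coloring V E k (c \<circ> prod.swap)"
proof -
  have "{p \<in> E\<inverse>. c p = i} = {p \<in> E. (c \<circ> prod.swap) p = i}\<inverse>" for i by auto
  then show ?thesis using assms by (force simp: wo_coloring_def odd_at_converse)
qed

text \<open>The classes \<open>F\<close> and \<open>G\<close> witness the condition; color 3 only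
  absorbs the remaining arcs.\<close>

lemma wo_coloring_3I:
  assumes "F \<subseteq> E" "G \<subseteq> E" "F \<inter> G = {}" "\<And>v. v \<in> V \<Longrightarrow> odd_at E F v \<or> odd_at E G v"
  shows "\<exists>c. wo_coloring V E 3 c"
proof -
  define c where "c = (\<lambda>p. if p \<in> F then 1 else if p \<in> G then 2 else (3::nat))"
  have c: "{p \<in> E. c p = 1} = F" "{p \<in> E. c p = 2} = G"
    using assms(1-3) by (auto simp: c_def split: if_splits)
  have "\<exists>i\<in>{1..3}. odd_at E {p \<in> E. c p = i} v" if "v \<in> V" for v
    using assms(4)[OF that]
  proof
    assume "odd_at E F v"
    then show ?thesis using c(1) by (intro bexI[of _ 1]) auto
  next
    assume "odd_at E G v"
    then show ?thesis using c(2) by (intro bexI[of _ 2]) auto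
  qed
  moreover have "c p \<in> {1..3}" for p by (simp add: c_def)
  ultimately have "wo_coloring V E 3 c" by (simp add: wo_coloring_def)
  then show ?thesis by blast
qed

lemma wo_coloring_2I:
  assumes "F \<subseteq> E" "\<And>v. v \<in> V \<Longrightarrow> odd_at E F v \<or> odd_at E (E - F) v"
  shows "\<exists>c. wo_coloring V E 2 c"
proof -
  define c where "c = (\<lambda>p. if p \<in> F then 1 else (2::nat))"
  have c: "{p \<in> E. c p = 1} = F" "{p \<in> E. c p = 2} = E - F"
    using assms(1) by (auto simp: c_def split: if_splits)
  have "\<exists>i\<in>{1..2}. odd_at E {p \<in> E. c p = i} v" if "v \<in> V" for v
    using assms(2)[OF that]
  proof
    assume "odd_at E F v"
    then show ?thesis using c(1) by (intro bexI[of _ 1]) auto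
  next
    assume "odd_at E (E - F) v"
    then show ?thesis using c(2) by (intro bexI[of _ 2]) auto
  qed
  moreover have "c p \<in> {1..2}" for p by (simp add: c_def)
  ultimately have "wo_coloring V E 2 c" by (simp add: wo_coloring_def)
  then show ?thesis by blast
qed

section \<open>Existence and nonexistence of two- and three-colorings\<close>

context semicomplete_rel
begin

lemma two_colors_no_peripheral:
  assumes "\<And>v. v \<in> V \<Longrightarrow> E `` {v} \<noteq> {} \<and> E\<inverse> `` {v} \<noteq> {}"
  shows "\<exists>c. wo_coloring V E 2 c"
proof -
  obtain F where "F \<subseteq> E" "\<forall>v\<in>V. odd (card (F `` {v})) \<and> odd (card (F\<inverse> `` {v}))"
    using exists_odd_factor[OF finite_V E_subset even_closed_sets[OF assms]] by blast
  then show ?thesis by (intro wo_coloring_2I) (auto simp: odd_at_def)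
qed

text \<open>Prescribed parities away from a source \<open>v\<close> are met by giving each \<open>u \<in> U\<close> one outgoing arc
  and then correcting the in-degrees with arcs leaving \<open>v\<close>.\<close>

lemma source_factor:
  assumes v: "v \<in> V" "E\<inverse> `` {v} = {}"
    and U: "U \<subseteq> V - {v}" and f: "\<And>u. u \<in> U \<Longrightarrow> (u, f u) \<in> E"
  shows "\<exists>F\<subseteq>E.
    (\<forall>u\<in>V - {v}. (odd (card (F `` {u})) \<longleftrightarrow> u \<in> U) \<and> (odd (card (F\<inverse> `` {u})) \<longleftrightarrow> u \<in> B)) \<and>
    (\<forall>u\<in>V - {v}. (v, u) \<in> F \<longleftrightarrow> odd (card {x \<in> U. f x = u}) \<noteq> (u \<in> B))"
proof -
  \<comment> \<open>The vertices whose in-degree parity, as produced by the arcs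
    \<open>(u, f u)\<close>, disagrees with \<open>B\<close>. As no arc enters \<open>v\<close>,
    semicompleteness supplies an arc from \<open>v\<close> to each of them.\<close>
  let ?W = "{w \<in> V - {v}. odd (card {x \<in> U. f x = w}) \<noteq> (w \<in> B)}"
  let ?F = "{(u, f u) |u. u \<in> U} \<union> {v} \<times> ?W"
  have vE: "(v, w) \<in> E" if "w \<in> V - {v}" for w using joined[of v w] v that by auto
  have vU: "v \<notin> U" using U by auto
  have finU: "finite U" using U finite_V finite_subset by blast
  have "?F \<subseteq> E" using f vE by auto
  moreover have "odd (card (?F `` {u})) \<longleftrightarrow> u \<in> U" if "u \<in> V - {v}" for u
  proof -
    have "?F `` {u} = (if u \<in> U then {f u} else {})" using that by auto
    then show ?thesis by simp
  qed
  moreover have "odd (card (?F\<inverse> `` {u})) \<longleftrightarrow> u \<in> B" if "u \<in> V - {v}" for u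
  proof -
    have "?F\<inverse> `` {u} = (if u \<in> ?W then insert v {x \<in> U. f x = u} else {x \<in> U. f x = u})"
      using that by auto
    then show ?thesis using that vU finU by auto
  qed
  \<comment> \<open>Recorded for the three-color construction, which needs an arc at
    \<open>v\<close> outside the factor.\<close>
  moreover have "(v, u) \<in> ?F \<longleftrightarrow> odd (card {x \<in> U. f x = u}) \<noteq> (u \<in> B)" if "u \<in> V - {v}" for u
    using that vU by auto
  ultimately show ?thesis by (intro exI[of _ ?F]) blast
qed

text \<open>Since no arc enters \<open>v\<close>, the handshake lemma forces its out-parity from the
  parities at all other vertices.\<close>

lemma source_parity:
  assumes v: "v \<in> V" "E\<inverse> `` {v} = {}" and F: "F \<subseteq> E"
    and parity: "\<forall>u\<in>V - {v}. (odd (card (F `` {u})) \<longleftrightarrow> u \<in> U) \<and> (odd (card (F\<inverse> `` {u})) \<longleftrightarrow> u \<in> B)"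
    and UB: "U \<subseteq> V - {v}" "B \<subseteq> V - {v}"
  shows "odd (card (F `` {v})) \<longleftrightarrow> odd (card U + card B)"
proof -
  have fin: "finite (V - {v})" using finite_V by simp
  have "F\<inverse> `` {v} = {}" using v F by auto
  moreover have "(\<Sum>u\<in>V. card (F `` {u})) = (\<Sum>u\<in>V. card (F\<inverse> `` {u}))"
    using sum_out_eq_sum_in[of V V F] finite_V F E_subset by auto
  ultimately have "card (F `` {v}) + (\<Sum>u\<in>V - {v}. card (F `` {u})) = (\<Sum>u\<in>V - {v}. card (F\<inverse> `` {u}))"
    using finite_V v(1) by (simp add: sum.remove)
  then have "odd (card (F `` {v})) \<longleftrightarrow>
      odd ((\<Sum>u\<in>V - {v}. card (F `` {u})) + (\<Sum>u\<in>V - {v}. card (F\<inverse> `` {u})))"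
    by presburger
  moreover have "{u \<in> V - {v}. odd (card (F `` {u}))} = U" "{u \<in> V - {v}. odd (card (F\<inverse> `` {u}))} = B"
    using parity UB by auto
  ultimately show ?thesis using fin by (simp add: even_sum_iff)
qed

text \<open>If \<open>v\<close> has odd out-degree, then \<open>F\<close> or \<open>E - F\<close> is
  odd at \<open>v\<close> whatever the parity of \<open>F\<close> there. Otherwise the parity at
  \<open>v\<close> must be made odd, using either a sink, which needs no odd out-parity, or a vertex
  of odd total degree, which can be served by \<open>E - F\<close> instead.\<close>

lemma two_colors_source:
  assumes v: "v \<in> V" "E\<inverse> `` {v} = {}"
    and cond: "odd (card (E `` {v})) \<or> (\<exists>s\<in>V - {v}. E `` {s} = {}) \<or>
      (\<exists>u\<in>V - {v}. odd (card (E `` {u}) + card (E\<inverse> `` {u})))"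
  shows "\<exists>c. wo_coloring V E 2 c"
proof -
  define f where "f u = (SOME w. (u, w) \<in> E)" for u
  have f: "(u, f u) \<in> E" if "E `` {u} \<noteq> {}" for u
    using that someI_ex[of "\<lambda>w. (u, w) \<in> E"] unfolding f_def by blast
  have fin: "finite (V - {v})" using finite_V by simp
  show ?thesis
  proof (cases "odd (card (E `` {v})) \<or> (\<exists>s\<in>V - {v}. E `` {s} = {})")
    case True
    let ?U = "{u \<in> V - {v}. E `` {u} \<noteq> {}}"
    have U: "?U \<subseteq> V - {v}" "\<And>u. u \<in> ?U \<Longrightarrow> (u, f u) \<in> E" using f by auto
    obtain F where F: "F \<subseteq> E"
      "\<forall>u\<in>V - {v}. (odd (card (F `` {u})) \<longleftrightarrow> u \<in> ?U) \<and> (odd (card (F\<inverse> `` {u})) \<longleftrightarrow> u \<in> V - {v})"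
      using source_factor[OF v U, of "V - {v}"] by blast
    have par: "odd (card (F `` {v})) \<longleftrightarrow> odd (card ?U + card (V - {v}))"
      by (rule source_parity[OF v F]) auto
    have "odd (card (F `` {v})) \<or> odd (card ((E - F) `` {v}))"
    proof (cases "odd (card (E `` {v}))")
      case True
      then show ?thesis using odd_card_Diff_Image(1)[OF F(1)] by blast
    next
      case False
      then obtain s where s: "s \<in> V - {v}" "E `` {s} = {}" using True by blast
      \<comment> \<open>Two sinks could not be joined, so \<open>s\<close> is the only one and the
        prescriptions \<open>?U\<close> and \<open>V - {v}\<close> differ in size by exactly
        one.\<close>
      have uniq: "E `` {s'} = {} \<longleftrightarrow> s' = s" if "s' \<in> V - {v}" for s'
        using joined[of s s'] that s by auto
      have "?U = V - {v} - {s}"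
        by (rule set_eqI) (use uniq in \<open>simp; blast\<close>)
      then have "card (V - {v}) = Suc (card ?U)" using fin s(1) by (metis card.remove)
      then show ?thesis using par by simp
    qed
    then have "odd_at E F v \<or> odd_at E (E - F) v" using v(2) by (auto simp: odd_at_def)
    moreover have "odd_at E F u" if "u \<in> V - {v}" for u
      using bspec[OF F(2) that] that by (auto simp: odd_at_def)
    ultimately show ?thesis using wo_coloring_2I[OF F(1)] by blast
  next
    case False
    then obtain x where x: "x \<in> V - {v}" "odd (card (E `` {x}) + card (E\<inverse> `` {x}))"
      using cond by blast
    have nosink: "E `` {u} \<noteq> {}" if "u \<in> V - {v}" for u using False that by blast
    \<comment> \<open>At \<open>x\<close> the parities of \<open>F\<close> are opposite to those of
      \<open>E\<close>, so that \<open>E - F\<close> is odd in both semi-cuts. The total degree of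
      \<open>x\<close> being odd, exactly one of the two sets loses \<open>x\<close>, which makes
      the total odd.\<close>
    let ?U = "{u \<in> V - {v}. u \<noteq> x \<or> even (card (E `` {x}))}"
    let ?B = "{u \<in> V - {v}. u \<noteq> x \<or> even (card (E\<inverse> `` {x}))}"
    have U: "?U \<subseteq> V - {v}" "\<And>u. u \<in> ?U \<Longrightarrow> (u, f u) \<in> E" using f nosink by auto
    obtain F where F: "F \<subseteq> E"
      "\<forall>u\<in>V - {v}. (odd (card (F `` {u})) \<longleftrightarrow> u \<in> ?U) \<and> (odd (card (F\<inverse> `` {u})) \<longleftrightarrow> u \<in> ?B)"
      using source_factor[OF v U, of ?B] by blast
    have par: "odd (card (F `` {v})) \<longleftrightarrow> odd (card ?U + card ?B)"
      by (rule source_parity[OF v F]) auto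
    have cx: "card (V - {v}) = Suc (card (V - {v} - {x}))" using fin x(1) by (metis card.remove)
    have "odd (card (F `` {v}))"
    proof (cases "even (card (E `` {x}))")
      case True
      then have "?U = V - {v}" "?B = V - {v} - {x}" using x by auto
      then show ?thesis using par cx by simp
    next
      case False
      then have "?U = V - {v} - {x}" "?B = V - {v}" using x by auto
      then show ?thesis using par cx by simp
    qed
    then have "odd_at E F v" using v(2) by (auto simp: odd_at_def)
    moreover have "odd_at E F u" if "u \<in> V - {v}" "u \<noteq> x" for u
      using bspec[OF F(2) that(1)] that by (auto simp: odd_at_def)
    moreover have "odd_at E (E - F) x"
      using bspec[OF F(2) x(1)] x(1) odd_card_Diff_Image[OF F(1), of x] by (auto simp: odd_at_def)
    ultimately show ?thesis using wo_coloring_2I[OF F(1)] by blast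
  qed
qed

text \<open>If all fibres of a choice of out-neighbours are even, then two vertices share their
  out-neighbour, and redirecting one of them to the other produces an odd fibre.\<close>

lemma exists_odd_fibre:
  assumes W: "W \<subseteq> V" "W \<noteq> {}" and nb: "\<And>u. u \<in> W \<Longrightarrow> \<exists>w\<in>W. (u, w) \<in> E"
  shows "\<exists>f. (\<forall>u\<in>W. (u, f u) \<in> E) \<and> (\<exists>w\<in>W. odd (card {u \<in> W. f u = w}))"
proof -
  obtain f where f: "\<And>u. u \<in> W \<Longrightarrow> f u \<in> W \<and> (u, f u) \<in> E" using nb by metis
  have fin: "finite W" using W finite_V finite_subset by blast
  show ?thesis
  proof (cases "\<exists>w\<in>W. odd (card {u \<in> W. f u = w})")
    case True
    then show ?thesis using f by blast
  next
    case False
    obtain x where x: "x \<in> W" using W by blast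
    define z where "z = f x"
    have "even (card {u \<in> W. f u = z})" using False f x z_def by blast
    then have "{u \<in> W. f u = z} \<noteq> {x}" by auto
    then obtain y where y: "y \<in> W" "f y = z" "y \<noteq> x" using x z_def by auto
    \<comment> \<open>\<open>a\<close> and \<open>b\<close> are \<open>x\<close> and
      \<open>y\<close>, named so that the arc between them leaves \<open>a\<close>; then
      \<open>a\<close> can be redirected to \<open>b\<close>.\<close>
    obtain a b where ab: "a \<in> W" "b \<in> W" "f a = z" "f b = z" "a \<noteq> b" "(a, b) \<in> E"
      using joined[of x y] x y W(1) z_def by auto
    \<comment> \<open>As \<open>f a = z\<close> differs from \<open>b\<close>, the redirection adds
      the new element \<open>a\<close> to the even fibre of \<open>b\<close>.\<close>
    have "b \<noteq> z" using f[OF ab(2)] ab(4) irrefl by auto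
    then have "{u \<in> W. (f(a := b)) u = b} = insert a {u \<in> W. f u = b}" "a \<notin> {u \<in> W. f u = b}"
      using ab by auto
    moreover have "even (card {u \<in> W. f u = b})" using False ab by blast
    ultimately have "odd (card {u \<in> W. (f(a := b)) u = b})" using fin by simp
    moreover have "(u, (f(a := b)) u) \<in> E" if "u \<in> W" for u using f that ab by auto
    ultimately show ?thesis using ab(2) by (intro exI[of _ "f(a := b)"]) blast
  qed
qed

text \<open>A factor \<open>F\<close> with odd parities everywhere off \<open>v\<close> serves all
  other vertices. If the fibre of \<open>w\<close> is odd, its in-degree needs no correction, so the
  arc \<open>(v, w)\<close> stays outside \<open>F\<close> and can form a class of its own serving
  \<open>v\<close>.\<close>

lemma three_colors_source:
  assumes v: "v \<in> V" "E\<inverse> `` {v} = {}" and ne: "V - {v} \<noteq> {}"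
    and nosink: "\<And>u. u \<in> V - {v} \<Longrightarrow> E `` {u} \<noteq> {}"
  shows "\<exists>c. wo_coloring V E 3 c"
proof -
  have "\<exists>w\<in>V - {v}. (u, w) \<in> E" if "u \<in> V - {v}" for u
    using nosink[OF that] v(2) E_subset by auto
  then obtain f w where f: "\<And>u. u \<in> V - {v} \<Longrightarrow> (u, f u) \<in> E"
    and w: "w \<in> V - {v}" "odd (card {u \<in> V - {v}. f u = w})"
    using exists_odd_fibre[OF Diff_subset ne] by blast
  obtain F where F: "F \<subseteq> E"
      "\<forall>u\<in>V - {v}. (odd (card (F `` {u})) \<longleftrightarrow> u \<in> V - {v}) \<and> (odd (card (F\<inverse> `` {u})) \<longleftrightarrow> u \<in> V - {v})"
      "\<forall>u\<in>V - {v}. (v, u) \<in> F \<longleftrightarrow> odd (card {x \<in> V - {v}. f x = u}) \<noteq> (u \<in> V - {v})"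
      using source_factor[OF v order_refl f, of "V - {v}"] by blast
  have "(v, w) \<notin> F" using bspec[OF F(3) w(1)] w by blast
  moreover have "(v, w) \<in> E" using joined[of v w] v w(1) by auto
  moreover have "{(v, w)} `` {v} = {w}" by auto
  then have "odd_at E {(v, w)} v" using v(2) by (auto simp: odd_at_def)
  moreover have "odd_at E F u" if "u \<in> V - {v}" for u
    using bspec[OF F(2) that] that by (auto simp: odd_at_def)
  ultimately show ?thesis using wo_coloring_3I[OF F(1), of "{(v, w)}" V] by blast
qed

text \<open>In an even digraph, a non-peripheral vertex meets evenly many arcs of color 1, whichever
  color serves it: both parities are odd, or both are opposite to degrees of equal parity. At
  \<open>v\<close> only one semi-cut is nonempty and its size is even, so either color makes the
  number odd. The sum over all vertices would then be odd, yet it counts every arc of color 1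
  twice.\<close>

lemma no_two_colors:
  assumes even: "\<And>u. u \<in> V \<Longrightarrow> even (card (E `` {u}) + card (E\<inverse> `` {u}))"
    and v: "v \<in> V" "E `` {v} = {} \<longleftrightarrow> E\<inverse> `` {v} \<noteq> {}"
    and nonper: "\<And>u. u \<in> V - {v} \<Longrightarrow> E `` {u} \<noteq> {} \<and> E\<inverse> `` {u} \<noteq> {}"
  shows "\<not> wo_coloring V E 2 c"
proof
  assume c: "wo_coloring V E 2 c"
  let ?F = "{p \<in> E. c p = 1}"
  have FE: "?F \<subseteq> E" by auto
  have "c p = 1 \<or> c p = 2" if "p \<in> E" for p using c that by (fastforce simp: wo_coloring_def)
  then have "{p \<in> E. c p = 2} = E - ?F" by auto
  moreover have "{1..2} = {1, 2::nat}" by auto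
  ultimately have col: "odd_at E ?F u \<or> odd_at E (E - ?F) u"
    if "u \<in> V" "E `` {u} \<noteq> {} \<or> E\<inverse> `` {u} \<noteq> {}" for u
    using c that unfolding wo_coloring_def by auto
  note diff = odd_card_Diff_Image[OF FE]
  have u: "even (card (?F `` {u}) + card (?F\<inverse> `` {u}))" if "u \<in> V - {v}" for u
    using col[of u] that nonper[OF that] even[of u] diff[of u] by (auto simp: odd_at_def)
  have "odd (card (?F `` {v}) + card (?F\<inverse> `` {v}))"
  proof (cases "E `` {v} = {}")
    case True
    then have "?F `` {v} = {}" by auto
    then show ?thesis using True col[of v] v even[of v] diff[of v] by (auto simp: odd_at_def)
  next
    case False
    then have "?F\<inverse> `` {v} = {}" using v by auto
    then show ?thesis using False col[of v] v even[of v] diff[of v] by (auto simp: odd_at_def)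
  qed
  then have "{u \<in> V. odd (card (?F `` {u}) + card (?F\<inverse> `` {u}))} = {v}" using u v(1) by blast
  then have "odd (\<Sum>u\<in>V. card (?F `` {u}) + card (?F\<inverse> `` {u}))"
    using even_sum_iff[OF finite_V, of "\<lambda>u. card (?F `` {u}) + card (?F\<inverse> `` {u})"] by simp
  moreover have "(\<Sum>u\<in>V. card (?F `` {u})) = (\<Sum>u\<in>V. card (?F\<inverse> `` {u}))"
    using sum_out_eq_sum_in[of V V ?F] finite_V E_subset by auto
  ultimately show False by (simp add: sum.distrib)
qed

lemma two_colors:
  assumes cond: "\<not> ((\<forall>v\<in>V. even (card (E `` {v}) + card (E\<inverse> `` {v}))) \<and>
      (\<exists>!v. v \<in> V \<and> (E `` {v} = {} \<or> E\<inverse> `` {v} = {})))"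
  shows "\<exists>c. wo_coloring V E 2 c"
proof (cases "\<exists>v\<in>V. E `` {v} = {} \<or> E\<inverse> `` {v} = {}")
  case False
  then show ?thesis using two_colors_no_peripheral by blast
next
  case True
  then obtain v where v: "v \<in> V" "E `` {v} = {} \<or> E\<inverse> `` {v} = {}" by blast
  interpret conv: semicomplete_rel V "E\<inverse>" by (rule semicomplete_rel_converse)
  have "(\<exists>u\<in>V - {v}. E `` {u} = {} \<or> E\<inverse> `` {u} = {}) \<or>
    (\<exists>u\<in>V. odd (card (E `` {u}) + card (E\<inverse> `` {u})))"
    using cond v by blast
  then have c: "(\<exists>u\<in>V - {v}. E `` {u} = {} \<or> E\<inverse> `` {u} = {}) \<or>
    odd (card (E `` {v}) + card (E\<inverse> `` {v})) \<or>
    (\<exists>u\<in>V - {v}. odd (card (E `` {u}) + card (E\<inverse> `` {u})))" by blast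
  show ?thesis
  proof (cases "E\<inverse> `` {v} = {}")
    case src: True
    \<comment> \<open>A second source could not be joined to \<open>v\<close>, so any further
      peripheral vertex is a sink.\<close>
    have "E\<inverse> `` {u} \<noteq> {}" if "u \<in> V - {v}" for u using joined[of v u] v(1) src that by auto
    with c have "odd (card (E `` {v})) \<or> (\<exists>s\<in>V - {v}. E `` {s} = {}) \<or>
      (\<exists>u\<in>V - {v}. odd (card (E `` {u}) + card (E\<inverse> `` {u})))"
      using src by auto
    then show ?thesis by (rule two_colors_source[OF v(1) src])
  next
    case False
    then have snk: "E `` {v} = {}" using v by blast
    have "E `` {u} \<noteq> {}" if "u \<in> V - {v}" for u using joined[of v u] v(1) snk that by auto
    with c have "odd (card (E\<inverse> `` {v})) \<or> (\<exists>s\<in>V - {v}. E\<inverse> `` {s} = {}) \<or>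
      (\<exists>u\<in>V - {v}. odd (card (E\<inverse> `` {u}) + card ((E\<inverse>)\<inverse> `` {u})))"
      using snk by (auto simp: add.commute)
    then have "\<exists>c. wo_coloring V (E\<inverse>) 2 c"
      using conv.two_colors_source[OF v(1)] snk by simp
    then show ?thesis using wo_coloring_converse by blast
  qed
qed

lemma three_colors:
  assumes nt: "V - {v} \<noteq> {}" and v: "v \<in> V" "E `` {v} = {} \<or> E\<inverse> `` {v} = {}"
    and nonper: "\<And>u. u \<in> V - {v} \<Longrightarrow> E `` {u} \<noteq> {} \<and> E\<inverse> `` {u} \<noteq> {}"
  shows "\<exists>c. wo_coloring V E 3 c"
proof (cases "E\<inverse> `` {v} = {}")
  case True
  then show ?thesis using three_colors_source[OF v(1) _ nt] nonper by blast
next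
  case False
  then have snk: "E `` {v} = {}" using v by blast
  interpret conv: semicomplete_rel V "E\<inverse>" by (rule semicomplete_rel_converse)
  have "\<exists>c. wo_coloring V (E\<inverse>) 3 c"
    by (rule conv.three_colors_source[OF v(1) _ nt]) (use nonper snk in auto)
  then show ?thesis using wo_coloring_converse by blast
qed

section \<open>Fewer than two colors, and monotonicity in the number of colors\<close>

lemma not_wo_coloring_0: "E \<noteq> {} \<Longrightarrow> \<not> wo_coloring V E 0 c"
  by (auto simp: wo_coloring_def)

lemma wo_coloring_1_iff:
  "(\<exists>c. wo_coloring V E 1 c) \<longleftrightarrow>
    (\<forall>v\<in>V. (odd (card (E `` {v})) \<or> card (E `` {v}) = 0) \<and>
      (odd (card (E\<inverse> `` {v})) \<or> card (E\<inverse> `` {v}) = 0))" (is "_ \<longleftrightarrow> ?R")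
proof -
  have R: "?R \<longleftrightarrow> (\<forall>v\<in>V. odd_at E E v)"
    by (auto simp: odd_at_def finite_Image_E card_eq_0_iff)
  have one: "{1..1} = {1::nat}" by auto
  show ?thesis
  proof
    assume "\<exists>c. wo_coloring V E 1 c"
    then obtain c where c: "wo_coloring V E 1 c" by blast
    then have "{p \<in> E. c p = 1} = E" by (auto simp: wo_coloring_def)
    then have "odd_at E E v" if "v \<in> V" for v
      using c that unfolding wo_coloring_def one by (auto simp: odd_at_def)
    then show ?R using R by simp
  next
    assume ?R
    then have "wo_coloring V E 1 (\<lambda>_. 1)" using R by (simp add: wo_coloring_def)
    then show "\<exists>c. wo_coloring V E 1 c" by blast
  qed
qed

end

lemma wo_coloring_mono:
  assumes "wo_coloring V E k c" "k \<le> l"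
  shows "wo_coloring V E l c"
proof -
  have "{1..k} \<subseteq> {1..l}" using assms(2) by auto
  then show ?thesis using assms(1) unfolding wo_coloring_def by blast
qed

section \<open>Transfer between digraphs and relations\<close>

context semicomplete_digraph
begin

lemma semicomplete_rel_arcs_ends: "semicomplete_rel (verts D) (arcs_ends D)"
  using semicomplete no_loops by unfold_locales (auto simp: arcs_ends_conv)

text \<open>Without parallel arcs, \<open>head\<close> is injective on the arcs leaving
  \<open>v\<close> and \<open>tail\<close> on those entering it.\<close>

lemma card_color_class:
  assumes "\<And>e. e \<in> arcs D \<Longrightarrow> \<phi> e = c (arc_to_ends D e)"
  shows "card {e \<in> out_arcs D v. \<phi> e = i} = card ({p \<in> arcs_ends D. c p = i} `` {v})"
    and "card {e \<in> in_arcs D v. \<phi> e = i} = card ({p \<in> arcs_ends D. c p = i}\<inverse> `` {v})"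
proof -
  have "inj_on (head D) {e \<in> out_arcs D v. \<phi> e = i}" "inj_on (tail D) {e \<in> in_arcs D v. \<phi> e = i}"
    by (auto intro!: inj_onI no_multi_arcs simp: arc_to_ends_def)
  moreover have "head D ` {e \<in> out_arcs D v. \<phi> e = i} = {p \<in> arcs_ends D. c p = i} `` {v}"
    using assms by (auto simp: arcs_ends_def arc_to_ends_def image_iff)
  moreover have "tail D ` {e \<in> in_arcs D v. \<phi> e = i} = {p \<in> arcs_ends D. c p = i}\<inverse> `` {v}"
    using assms by (auto simp: arcs_ends_def arc_to_ends_def image_iff)
  ultimately show "card {e \<in> out_arcs D v. \<phi> e = i} = card ({p \<in> arcs_ends D. c p = i} `` {v})"
    "card {e \<in> in_arcs D v. \<phi> e = i} = card ({p \<in> arcs_ends D. c p = i}\<inverse> `` {v})"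
    using card_image by fastforce+
qed

lemma degree_eq_card_Image:
  "out_degree D v = card (arcs_ends D `` {v})" "in_degree D v = card ((arcs_ends D)\<inverse> `` {v})"
  \<comment> \<open>Under a constant coloring the color class is the whole arc set.\<close>
  using card_color_class[of "\<lambda>_. 0" "\<lambda>_. 0" v 0]
  by (simp_all add: out_degree_def in_degree_def out_arcs_def in_arcs_def)

lemma semicut_empty_iff:
  "out_arcs D v = {} \<longleftrightarrow> arcs_ends D `` {v} = {}" "in_arcs D v = {} \<longleftrightarrow> (arcs_ends D)\<inverse> `` {v} = {}"
  by (fastforce simp: arcs_ends_conv)+

lemma peripheral_iff: "peripheral D v \<longleftrightarrow> arcs_ends D `` {v} = {} \<or> (arcs_ends D)\<inverse> `` {v} = {}"
proof -
  interpret R: semicomplete_rel "verts D" "arcs_ends D" by (rule semicomplete_rel_arcs_ends)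
  show ?thesis by (simp add: peripheral_def degree_eq_card_Image R.finite_Image_E)
qed

lemma weak_odd_edge_coloring_iff:
  assumes "\<And>e. e \<in> arcs D \<Longrightarrow> \<phi> e = c (arc_to_ends D e)"
  shows "weak_odd_edge_coloring D k \<phi> \<longleftrightarrow> wo_coloring (verts D) (arcs_ends D) k c"
proof -
  have "\<phi> \<in> arcs D \<rightarrow> {1..k} \<longleftrightarrow> (\<forall>p\<in>arcs_ends D. c p \<in> {1..k})"
    using assms by (simp add: arcs_ends_def Pi_iff)
  then show ?thesis
    by (simp add: weak_odd_edge_coloring_def weak_odd_at_def wo_coloring_def odd_at_def
        card_color_class[of \<phi> c, OF assms] semicut_empty_iff
        del: in_out_arcs_conv in_in_arcs_conv)
qed

lemma ex_weak_odd_edge_coloring_iff: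
  "(\<exists>\<phi>. weak_odd_edge_coloring D k \<phi>) \<longleftrightarrow> (\<exists>c. wo_coloring (verts D) (arcs_ends D) k c)"
proof
  assume "\<exists>\<phi>. weak_odd_edge_coloring D k \<phi>"
  then obtain \<phi> where "weak_odd_edge_coloring D k \<phi>" by blast
  \<comment> \<open>Since \<open>arc_to_ends\<close> is injective on arcs, a coloring of arcs
    descends to their end pairs.\<close>
  then have "wo_coloring (verts D) (arcs_ends D) k (\<phi> \<circ> inv_into (arcs D) (arc_to_ends D))"
    using weak_odd_edge_coloring_iff[of \<phi> "\<phi> \<circ> inv_into (arcs D) (arc_to_ends D)"]
    by (simp add: inv_into_f_f[OF inj_on_arc_to_ends])
  then show "\<exists>c. wo_coloring (verts D) (arcs_ends D) k c" by blast
next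
  assume "\<exists>c. wo_coloring (verts D) (arcs_ends D) k c"
  then obtain c where "wo_coloring (verts D) (arcs_ends D) k c" by blast
  then have "weak_odd_edge_coloring D k (c \<circ> arc_to_ends D)"
    using weak_odd_edge_coloring_iff[of "c \<circ> arc_to_ends D" c] by simp
  then show "\<exists>\<phi>. weak_odd_edge_coloring D k \<phi>" by blast
qed

lemma complete_digraph_1_iff: "complete_digraph 1 D \<longleftrightarrow> card (verts D) = 1"
proof
  assume "card (verts D) = 1"
  then obtain x where x: "verts D = {x}" by (auto simp: card_1_singleton_iff)
  have "arcs D = {}"
  proof (rule ccontr)
    assume "arcs D \<noteq> {}"
    then obtain e where "e \<in> arcs D" by blast
    then show False using no_loops[of e] tail_in_verts[of e] head_in_verts[of e] x by auto
  qed
  then have "arcs_ends D = {}" by (simp add: arcs_ends_def)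
  moreover from this have "graph D" by (intro graphI) (simp add: symmetric_def sym_def)
  ultimately show "complete_digraph 1 D" using x by (auto simp: complete_digraph_def)
qed (simp add: complete_digraph_def)

end

section \<open>Evaluation of the index case by case\<close>

theorem theorem3p1:
  fixes D :: "('a, 'b) pre_digraph"
  assumes "semicomplete_digraph D"
    and "verts D \<noteq> {}"
  shows "weak_odd_chromatic_index D =
    (if complete_digraph 1 D then 0
     else if nontrivial_digraph D \<and>
       (\<forall>v\<in>verts D. (odd (out_degree D v) \<or> out_degree D v = 0) \<and>
                    (odd (in_degree D v) \<or> in_degree D v = 0)) then 1
     else if nontrivial_digraph D \<and> even_digraph D \<and>
       (\<exists>!v. v \<in> verts D \<and> peripheral D v) then 3
     else 2)"
proof -
  interpret semicomplete_digraph D by (rule assms(1))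
  interpret R: semicomplete_rel "verts D" "arcs_ends D" by (rule semicomplete_rel_arcs_ends)
  define C where "C k \<longleftrightarrow> (\<exists>c. wo_coloring (verts D) (arcs_ends D) k c)" for k
  have mono: "C l" if "C k" "k \<le> l" for k l
    using that wo_coloring_mono unfolding C_def by blast
  \<comment> \<open>By monotonicity, minimality of \<open>k\<close> needs failure only for its
    predecessor; for \<open>k = 0\<close> that condition is vacuous.\<close>
  have index: "weak_odd_chromatic_index D = k" if k: "C k" "\<And>j. k = Suc j \<Longrightarrow> \<not> C j" for k
    unfolding weak_odd_chromatic_index_def ex_weak_odd_edge_coloring_iff C_def[symmetric]
  proof (rule Least_equality)
    fix l assume "C l"
    then show "k \<le> l" using k(2)[of "k - 1"] mono[of l "k - 1"] by (cases k) force+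
  qed (rule k(1))
  show ?thesis
  proof (cases "card (verts D) = 1")
    case True
    then obtain x where x: "verts D = {x}" by (auto simp: card_1_singleton_iff)
    then have "arcs_ends D = {}" using R.E_subset R.irrefl by auto
    then have "C 0" unfolding C_def wo_coloring_def by simp
    then show ?thesis using index[of 0] True complete_digraph_1_iff by simp
  next
    case False
    have fin: "finite (verts D)" by simp
    have "card (verts D) \<noteq> 0" using assms(2) fin by simp
    with False have card: "card (verts D) > 1" by linarith
    then have nontriv: "nontrivial_digraph D" by (simp add: nontrivial_digraph_def)
    have other: "verts D - {v} \<noteq> {}" for v
    proof
      assume "verts D - {v} = {}"
      then have "verts D \<subseteq> {v}" by blast
      then have "card (verts D) \<le> card {v}" by (intro card_mono) auto
      then show False using card by simp
    qed
    \<comment> \<open>Excludes isolated vertices: this rules out zero colors and makes a peripheral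
      vertex have exactly one empty semi-cut.\<close>
    have noniso: "arcs_ends D `` {v} \<noteq> {} \<or> (arcs_ends D)\<inverse> `` {v} \<noteq> {}" if v: "v \<in> verts D" for v
    proof -
      obtain u where "u \<in> verts D" "u \<noteq> v" using other[of v] by blast
      then show ?thesis using R.joined[of u v] v by auto
    qed
    have C0: "\<not> C 0" using R.not_wo_coloring_0 noniso assms(2) unfolding C_def by blast
    let ?A = "\<forall>v\<in>verts D. (odd (out_degree D v) \<or> out_degree D v = 0) \<and>
                    (odd (in_degree D v) \<or> in_degree D v = 0)"
    have C1: "C 1 \<longleftrightarrow> ?A"
      unfolding C_def R.wo_coloring_1_iff degree_eq_card_Image by simp
    let ?B = "even_digraph D \<and> (\<exists>!v. v \<in> verts D \<and> peripheral D v)"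
    have C2: "C 2" if "\<not> ?B"
      using R.two_colors that unfolding C_def even_digraph_def total_degree_def
        degree_eq_card_Image peripheral_iff by blast
    have C3: "C 3 \<and> \<not> C 2" if B: ?B
    proof -
      obtain v where v: "v \<in> verts D" "peripheral D v"
        and uniq: "\<And>u. u \<in> verts D \<Longrightarrow> peripheral D u \<Longrightarrow> u = v" using B by blast
      have np: "arcs_ends D `` {u} \<noteq> {} \<and> (arcs_ends D)\<inverse> `` {u} \<noteq> {}" if "u \<in> verts D - {v}" for u
        using uniq[of u] that unfolding peripheral_iff by blast
      have "C 3" unfolding C_def
        by (rule R.three_colors[OF other v(1) _ np]) (use v(2) in \<open>simp_all add: peripheral_iff\<close>)
      moreover have "\<not> wo_coloring (verts D) (arcs_ends D) 2 c" for c
      proof (rule R.no_two_colors[OF _ v(1) _ np])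
        show "even (card (arcs_ends D `` {u}) + card ((arcs_ends D)\<inverse> `` {u}))" if "u \<in> verts D" for u
          using B that unfolding even_digraph_def total_degree_def degree_eq_card_Image by blast
        show "arcs_ends D `` {v} = {} \<longleftrightarrow> (arcs_ends D)\<inverse> `` {v} \<noteq> {}"
          using noniso[OF v(1)] v(2) unfolding peripheral_iff by blast
      qed
      ultimately show ?thesis unfolding C_def by blast
    qed
    consider ?A | "\<not> ?A" ?B | "\<not> ?A" "\<not> ?B" by argo
    then show ?thesis
    proof cases
      case 1
      then have "weak_odd_chromatic_index D = 1" using index[of 1] C0 C1 by simp
      then show ?thesis using 1 nontriv False complete_digraph_1_iff by simp
    next
      case 2
      then have "weak_odd_chromatic_index D = 3"
        using index[of 3] C3 by (simp add: eval_nat_numeral)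
      then show ?thesis using 2 nontriv False complete_digraph_1_iff by simp
    next
      case 3
      then have "weak_odd_chromatic_index D = 2"
        using index[of 2] C2 C1 by (simp add: eval_nat_numeral)
      then show ?thesis using 3 nontriv False complete_digraph_1_iff by simp
    qed
  qed
qed

end
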